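(* Let $\varphi: T\to T$ be a self-map of the rooted tree $T$ and let $\mathcal{A}=\{v\in T : \varphi \text{ is not constant on } S_v\}$. The composition operator $C_\varphi$ is bounded on $\mathcal{L}_0$ if and only if both of the following hold: (i) $\varphi$ is Lipschitz; and (ii) either $\mathcal{A}$ is finite, or $\mathcal{A}$ is infinite and $\lim_{|v|\to\infty,\ v\in\mathcal{A}}|\varphi(v)|=\infty$.
   Context: $T$ is an infinite, locally finite tree (connected graph without cycles, identified with its vertex set) with a chosen root $o$, in which every vertex except possibly $o$ has degree greater than $1$. $d(v,w)$ is the number of edges of the unique path joining $v$ and $w$, and $|v|=d(o,v)$. $T^*=T\setminus\{o\}$. For $v\in T^*$, the parent $v^-$ is the neighbor of $v$ on the path from $o$ to $v$. The sector $S_v$ is the set consisting of $v$ and all its descendants (the vertices $u$ such that $v$ lies on the path from $o$ to $u$). The Lipschitz space $\mathcal{L}$ is the set of $f:T\to\mathbb{C}$ with $\sup_{v\in T^*}|f(v)-f(v^-)|<\infty$, a Banach space under $\|f\|_{\mathcal{L}}=\max\{|f(o)|,\sup_{v\in T^*}|f(v)-f(v^-)|\}$. The little Lipschitz space $\mathcal{L}_0$ is the closed subspace of $f\in\mathcal{L}$ with $\lim_{|v|\to\infty}|f(v)-f(v^-)|=0$. A map $\varphi:T\to T$ is Lipschitz if $\sup_{v\ne w} d(\varphi(v),\varphi(w))/d(v,w)<\infty$. The composition operator is $C_\varphi f=f\circ\varphi$; it is bounded on $\mathcal{L}_0$ if it maps $\mathcal{L}_0$ into itself and is a bounded operator there.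 "$\lim_{|v|\to\infty,\,v\in\mathcal{A}}|\varphi(v)|=\infty$" means: for every $M$ there is $N$ such that $|\varphi(v)|>M$ for all $v\in\mathcal{A}$ with $|v|>N$. *)

theory Defs
  imports "HOL-Analysis.Analysis" "Graph_Theory.Pair_Digraph" "Graph_Theory.Digraph_Component"
begin

text \<open>
  An undirected simple graph is a symmetric loop-free digraph without parallel arcs
  (\<^locale>\<open>pair_bidirected_digraph\<close>), each edge being a pair of opposite arcs. In such a digraph
  the closed walk \<open>a, b, a\<close> counts as a \<^const>\<open>pre_digraph.cycle\<close>, so the undirected cycles are
  those of length at least 3, and \<^const>\<open>Digraph_Component.tree\<close> would be the wrong notion here.
\<close>

locale infinite_rooted_tree = pair_bidirected_digraph T
  for T :: "'a pair_pre_digraph" +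
  fixes r :: 'a
  assumes connected: "Digraph_Component.connected (with_proj T)"
    and acyclic: "\<not> (\<exists>p. pre_digraph.cycle (with_proj T) p \<and> length p \<ge> 3)"
    and infinite_verts: "infinite (pverts T)"
    and locally_finite: "\<And>v. v \<in> pverts T \<Longrightarrow> finite (out_arcs (with_proj T) v)"
    and root_in_verts: "r \<in> pverts T"
    and degree_gt_1: "\<And>v. v \<in> pverts T \<Longrightarrow> v \<noteq> r \<Longrightarrow> out_degree (with_proj T) v > 1"

definition tree_path :: "'a pair_pre_digraph \<Rightarrow> 'a \<Rightarrow> 'a \<Rightarrow> ('a \<times> 'a) awalk" where
  "tree_path T v w = (THE p. pre_digraph.apath (with_proj T) v p w)"

definition path_verts :: "'a pair_pre_digraph \<Rightarrow> 'a \<Rightarrow> 'a \<Rightarrow> 'a set" where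
  "path_verts T v w = set (pre_digraph.awalk_verts (with_proj T) v (tree_path T v w))"

definition tree_dist :: "'a pair_pre_digraph \<Rightarrow> 'a \<Rightarrow> 'a \<Rightarrow> nat" where
  "tree_dist T v w = length (tree_path T v w)"

definition depth :: "'a pair_pre_digraph \<Rightarrow> 'a \<Rightarrow> 'a \<Rightarrow> nat" where
  "depth T r v = tree_dist T r v"

definition parent :: "'a pair_pre_digraph \<Rightarrow> 'a \<Rightarrow> 'a \<Rightarrow> 'a" where
  "parent T r v = (THE u. (v, u) \<in> parcs T \<and> u \<in> path_verts T r v)"

definition sector :: "'a pair_pre_digraph \<Rightarrow> 'a \<Rightarrow> 'a \<Rightarrow> 'a set" where
  "sector T r v = {u \<in> pverts T. v \<in> path_verts T r u}"

definition increment :: "'a pair_pre_digraph \<Rightarrow> 'a \<Rightarrow> ('a \<Rightarrow> complex) \<Rightarrow> 'a \<Rightarrow> real" where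
  "increment T r f v = cmod (f v - f (parent T r v))"

text \<open>
  Functions on the vertex set are represented by the members of \<^term>\<open>extensional (pverts T)\<close>, so
  that equality of functions is equality on the vertices.
\<close>

definition Lipschitz_space :: "'a pair_pre_digraph \<Rightarrow> 'a \<Rightarrow> ('a \<Rightarrow> complex) set" where
  "Lipschitz_space T r =
    {f \<in> extensional (pverts T). bdd_above (increment T r f ` (pverts T - {r}))}"

definition Lipschitz_norm :: "'a pair_pre_digraph \<Rightarrow> 'a \<Rightarrow> ('a \<Rightarrow> complex) \<Rightarrow> real" where
  "Lipschitz_norm T r f =
    max (cmod (f r)) (SUP v \<in> pverts T - {r}. increment T r f v)"

definition little_Lipschitz_space :: "'a pair_pre_digraph \<Rightarrow> 'a \<Rightarrow> ('a \<Rightarrow> complex) set" where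
  "little_Lipschitz_space T r =
    {f \<in> Lipschitz_space T r.
      \<forall>\<epsilon>>0. \<exists>N. \<forall>v \<in> pverts T - {r}. depth T r v > N \<longrightarrow> increment T r f v < \<epsilon>}"

definition Lipschitz_map :: "'a pair_pre_digraph \<Rightarrow> ('a \<Rightarrow> 'a) \<Rightarrow> bool" where
  "Lipschitz_map T \<phi> \<longleftrightarrow>
    bdd_above {real (tree_dist T (\<phi> v) (\<phi> w)) / real (tree_dist T v w) | v w.
      v \<in> pverts T \<and> w \<in> pverts T \<and> v \<noteq> w}"

definition composition_operator ::
  "'a pair_pre_digraph \<Rightarrow> ('a \<Rightarrow> 'a) \<Rightarrow> ('a \<Rightarrow> complex) \<Rightarrow> ('a \<Rightarrow> complex)" where
  "composition_operator T \<phi> f = compose (pverts T) f \<phi>"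

definition bounded_operator_on ::
  "'a set \<Rightarrow> ('a \<Rightarrow> complex) set \<Rightarrow> (('a \<Rightarrow> complex) \<Rightarrow> real) \<Rightarrow>
    (('a \<Rightarrow> complex) \<Rightarrow> ('a \<Rightarrow> complex)) \<Rightarrow> bool" where
  "bounded_operator_on V X N A \<longleftrightarrow>
    (\<forall>f \<in> X. A f \<in> X) \<and>
    (\<forall>f \<in> X. \<forall>g \<in> X. A (\<lambda>v\<in>V. f v + g v) = (\<lambda>v\<in>V. A f v + A g v)) \<and>
    (\<forall>c. \<forall>f \<in> X. A (\<lambda>v\<in>V. c * f v) = (\<lambda>v\<in>V. c * A f v)) \<and>
    (\<exists>K. \<forall>f \<in> X. N (A f) \<le> K * N f)"

definition nonconstant_verts :: "'a pair_pre_digraph \<Rightarrow> 'a \<Rightarrow> ('a \<Rightarrow> 'a) \<Rightarrow> 'a set" where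
  "nonconstant_verts T r \<phi> = {v \<in> pverts T. \<not> \<phi> constant_on sector T r v}"

definition depth_tends_to_infinity_on ::
  "'a pair_pre_digraph \<Rightarrow> 'a \<Rightarrow> ('a \<Rightarrow> 'a) \<Rightarrow> 'a set \<Rightarrow> bool" where
  "depth_tends_to_infinity_on T r \<phi> A \<longleftrightarrow>
    (\<forall>M. \<exists>N. \<forall>v \<in> A. depth T r v > N \<longrightarrow> depth T r (\<phi> v) > M)"

end

theory Submission
  imports Defs
begin

text \<open>
  Everything is read off the truncated distances \<open>min (d(c, \<cdot>)) n\<close>, normalised to vanish at the
  root: by local finiteness they have only finitely many nonzero increments, so they lie in the
  little Lipschitz space, and their norm is at most 1. Taking \<open>c\<close> and \<open>n\<close> to be the image of \<open>v\<^sup>-\<close>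
  and its distance from the image of \<open>v\<close>, boundedness of the operator bounds that distance. For
  \<open>n = 1\<close> the function detects departure from \<open>c\<close>: if \<open>v\<close> is a vertex with image \<open>c\<close> on whose
  sector \<open>\<phi>\<close> is not constant, then the composition has increment 1 at some vertex below \<open>v\<close>,
  which for each \<open>c\<close> can happen only for \<open>v\<close> of bounded depth; there are finitely many \<open>c\<close> of given
  depth. Conversely, an increment of \<open>f \<circ> \<phi>\<close> is a sum of boundedly many increments of \<open>f\<close> along the
  path between the images of \<open>v\<^sup>-\<close> and \<open>v\<close>, and when it is nonzero at a deep vertex \<open>v\<close>, then \<open>v\<^sup>-\<close>
  is nonconstant, so that this path stays far from the root.
\<close>

context infinite_rooted_tree
begin

section \<open>Existence and uniqueness of paths\<close>

lemma apath_decomp: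
  assumes "apath u p v" "x \<in> set (awalk_verts u p)"
  obtains q s where "p = q @ s" "apath u q x" "apath x s v"
proof -
  obtain q s where qs: "p = q @ s" "awalk u q x" "awalk x s v"
    using awalk_decomp assms by (metis apath_def)
  moreover have "awlast u q = x"
    using qs(2) by auto
  ultimately show ?thesis
    using that[of q s] assms(1) by (simp add: apath_append_iff)
qed

text \<open>Induction on the total length of the two paths. A common inner vertex cuts each path
  into two nonempty pieces, and the corresponding pieces agree by induction; without such a vertex
  the paths would close up to a cycle, contradicting \<open>acyclic\<close>.\<close>

lemma apath_unique:
  assumes "apath u p v" "apath u q v"
  shows "p = q"
  using assms
proof (induction "length p + length q" arbitrary: u v p q rule: less_induct)
  case less
  have walks: "awalk u p v" "awalk u q v"
    and dist: "distinct (awalk_verts u p)" "distinct (awalk_verts u q)"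
    using less.prems by (auto simp: apath_def)
  show ?case
  proof (cases "\<exists>x \<in> set (awalk_verts u p) \<inter> set (awalk_verts u q). x \<noteq> u \<and> x \<noteq> v")
    case True
    then obtain x where x: "x \<in> set (awalk_verts u p)" "x \<in> set (awalk_verts u q)" "x \<noteq> u" "x \<noteq> v"
      by blast
    obtain p1 p2 where p: "p = p1 @ p2" "apath u p1 x" "apath x p2 v"
      using apath_decomp[OF less.prems(1) x(1)] by blast
    obtain q1 q2 where q: "q = q1 @ q2" "apath u q1 x" "apath x q2 v"
      using apath_decomp[OF less.prems(2) x(2)] by blast
    have "p1 \<noteq> []" "p2 \<noteq> []" "q1 \<noteq> []" "q2 \<noteq> []"
      using x p q by (auto simp: apath_Nil_iff)
    then have "p1 = q1" "p2 = q2"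
      using less.hyps[of p1 q1 u x] less.hyps[of p2 q2 x v] p q by auto
    then show ?thesis
      using p q by simp
  next
    case False
    show ?thesis
    proof (cases "u = v")
      case True
      then show ?thesis
        using less.prems apath_nonempty_ends by metis
    next
      case False
      then have ne: "p \<noteq> []" "q \<noteq> []"
        using walks by (auto simp: awalk_Nil_iff)
      \<comment> \<open>With no common inner vertex this is a cycle, and it has length at least 3 unless both
        paths consist of the single arc from \<open>u\<close> to \<open>v\<close>.\<close>
      let ?c = "p @ rev_path q"
      have c: "awalk u ?c u"
        using walks awalk_appendI awalk_rev_path by blast
      have hd_p: "awalk_verts u p = u # tl (awalk_verts u p)"
        using walks(1) by (metis awhd_of_awalk awalk_verts_non_Nil list.collapse)
      have hd_q: "rev (awalk_verts u q) = v # tl (rev (awalk_verts u q))"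
        using walks(2) by (metis awlast_if_cas awalkE' awalk_verts_non_Nil hd_rev list.collapse rev_is_Nil_conv)
      have verts: "tl (awalk_verts u ?c) = tl (awalk_verts u p) @ tl (rev (awalk_verts u q))"
        using c walks awalk_verts_rev_path[OF walks(2)] hd_p
        by (subst awalk_verts_append) (auto simp: tl_append split: list.splits)
      have "u \<notin> set (tl (awalk_verts u p))" "v \<notin> set (tl (rev (awalk_verts u q)))"
        using dist hd_p hd_q by (metis distinct.simps(2), metis distinct.simps(2) distinct_rev)
      moreover have "set (tl (awalk_verts u p)) \<subseteq> set (awalk_verts u p)"
        "set (tl (rev (awalk_verts u q))) \<subseteq> set (awalk_verts u q)"
        by (metis hd_p set_subset_Cons, metis hd_q set_rev set_subset_Cons)
      ultimately have "distinct (tl (awalk_verts u ?c))"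
        unfolding verts using dist \<open>\<not> (\<exists>x \<in> _ \<inter> _. _ x)\<close> by (auto simp: distinct_tl)
      then have "cycle ?c"
        using c ne by (auto simp: cycle_def)
      then have "\<not> length ?c \<ge> 3"
        using acyclic by blast
      moreover have "length (rev_path q) = length q"
        by (induction q) auto
      ultimately have "length p + length q < 3"
        by simp
      then have "length p = 1" "length q = 1"
        using ne by (cases p; cases q; auto)+
      then show ?thesis
        using walks by (auto simp: length_Suc_conv awalk_simps prod_eq_iff)
    qed
  qed
qed

lemma tree_path_eq: "tree_path T u v = p" if "apath u p v"
  unfolding tree_path_def using that apath_unique by blast

text \<open>The existence half of the description in \<open>tree_path\<close>: in a symmetric
  digraph connectedness gives reachability along arcs, and repeated vertices can be cut out of a
  walk.\<close>

lemma apath_tree_path: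
  assumes "u \<in> pverts T" "v \<in> pverts T"
  shows "apath u (tree_path T u v) v"
proof -
  have "strongly_connected (with_proj T)"
    using connected sym_arcs symmetric_connected_imp_strongly_connected by auto
  then have "u \<rightarrow>\<^sup>*\<^bsub>with_proj T\<^esub> v"
    using assms by (auto simp: strongly_connected_def)
  then show ?thesis
    using reachable_apath tree_path_eq by metis
qed

section \<open>The tree metric and finiteness of balls\<close>

text \<open>Cutting the loops out of a walk leaves the unique path, whose arcs are distinct and all
  occur in the walk. Upper bounds on distances can therefore be obtained by exhibiting any
  walk.\<close>

lemma tree_dist_le_length:
  assumes "awalk u p v"
  shows "tree_dist T u v \<le> length p"
proof -
  have ap: "apath u (awalk_to_apath p) v"
    using apath_awalk_to_apath[OF assms] .
  then have "distinct (awalk_to_apath p)"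
    by (auto simp: apath_def intro: distinct_verts_imp_distinct)
  then have "length (awalk_to_apath p) \<le> length p"
    using awalk_to_apath_subset[OF assms]
    by (metis card_length card_mono distinct_card finite_set le_trans)
  then show ?thesis
    by (simp add: tree_dist_def tree_path_eq[OF ap])
qed

lemma tree_dist_walk:
  assumes "u \<in> pverts T" "v \<in> pverts T"
  obtains p where "awalk u p v" "length p = tree_dist T u v"
  using apath_tree_path[OF assms] by (auto simp: apath_def tree_dist_def)

lemma tree_dist_self [simp]: "u \<in> pverts T \<Longrightarrow> tree_dist T u u = 0"
  using tree_dist_le_length[of u "[]" u] by (simp add: awalk_Nil_iff)

lemma tree_dist_eq_0_iff:
  assumes "u \<in> pverts T" "v \<in> pverts T"
  shows "tree_dist T u v = 0 \<longleftrightarrow> u = v"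
  using tree_dist_walk[OF assms] assms by (metis awalk_Nil_iff length_0_conv tree_dist_self)

lemma tree_dist_commute:
  assumes "u \<in> pverts T" "v \<in> pverts T"
  shows "tree_dist T u v = tree_dist T v u"
proof -
  have "tree_dist T a b \<le> tree_dist T b a" if ab: "a \<in> pverts T" "b \<in> pverts T" for a b
  proof -
    obtain p where p: "awalk b p a" "length p = tree_dist T b a"
      using tree_dist_walk[OF ab(2) ab(1)] by blast
    moreover have "length (rev_path p) = length p"
      by (induction p) auto
    ultimately show ?thesis
      using tree_dist_le_length[of a "rev_path p" b] by simp
  qed
  then show ?thesis
    using assms by (simp add: antisym)
qed

lemma tree_dist_triangle:
  assumes "u \<in> pverts T" "v \<in> pverts T" "w \<in> pverts T"
  shows "tree_dist T u w \<le> tree_dist T u v + tree_dist T v w"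
proof -
  obtain p where p: "awalk u p v" "length p = tree_dist T u v"
    using tree_dist_walk assms by metis
  obtain q where q: "awalk v q w" "length q = tree_dist T v w"
    using tree_dist_walk assms by metis
  show ?thesis
    using tree_dist_le_length[OF awalk_appendI[OF p(1) q(1)]] p q by simp
qed

lemma tree_dist_arc_le: "(u, v) \<in> parcs T \<Longrightarrow> tree_dist T u v \<le> 1"
  using tree_dist_le_length[of u "[(u, v)]" v] by (auto simp: awalk_simps in_arcsD2)

lemma tree_dist_on_walk:
  assumes "awalk u p v" "x \<in> set (awalk_verts u p)"
  shows "tree_dist T u x \<le> length p"
proof -
  obtain q s where "p = q @ s" "awalk u q x"
    using awalk_decomp[OF assms] by blast
  then show ?thesis
    using tree_dist_le_length[of u q x] by simp
qed

text \<open>Induction on the radius: removing the last arc of a shortest walk lands in the smaller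
  ball, from which only finitely many arcs leave by local finiteness.\<close>

lemma finite_tree_ball:
  assumes "c \<in> pverts T"
  shows "finite {v \<in> pverts T. tree_dist T c v \<le> n}"
proof (induction n)
  case 0
  have "{v \<in> pverts T. tree_dist T c v \<le> 0} \<subseteq> {c}"
    using assms tree_dist_eq_0_iff by auto
  then show ?case
    by (rule finite_subset) simp
next
  case (Suc n)
  let ?B = "{v \<in> pverts T. tree_dist T c v \<le> n}"
  have "{v \<in> pverts T. tree_dist T c v \<le> Suc n}
      \<subseteq> {c} \<union> (\<Union>u \<in> ?B. snd ` out_arcs (with_proj T) u)"
  proof
    fix v assume "v \<in> {v \<in> pverts T. tree_dist T c v \<le> Suc n}"
    then have v: "v \<in> pverts T" "tree_dist T c v \<le> Suc n"
      by auto
    obtain p where p: "awalk c p v" "length p = tree_dist T c v"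
      using tree_dist_walk assms v by metis
    show "v \<in> {c} \<union> (\<Union>u \<in> ?B. snd ` out_arcs (with_proj T) u)"
    proof (cases p rule: rev_cases)
      case Nil
      then show ?thesis
        using p by (simp add: awalk_Nil_iff)
    next
      case (snoc q e)
      then have "awalk c q (fst e)" "e \<in> parcs T" "snd e = v"
        using p by (auto simp: awalk_simps)
      moreover have "length q \<le> n"
        using snoc p v by simp
      ultimately have "fst e \<in> ?B" "e \<in> out_arcs (with_proj T) (fst e)"
        using tree_dist_le_length[of c q "fst e"] by (auto simp: arc_fst_in_verts)
      then show ?thesis
        using \<open>snd e = v\<close> by blast
    qed
  qed
  moreover have "finite ({c} \<union> (\<Union>u \<in> ?B. snd ` out_arcs (with_proj T) u))"
    using Suc locally_finite by auto
  ultimately show ?case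
    by (rule finite_subset)
qed

section \<open>Parents and depth\<close>

lemma self_in_path_verts:
  assumes "v \<in> pverts T"
  shows "v \<in> path_verts T r v"
proof -
  have "awlast r (tree_path T r v) = v"
    using apath_tree_path root_in_verts assms by (auto simp: apath_def)
  then show ?thesis
    unfolding path_verts_def by (metis awalk_verts_non_Nil last_in_set awalk_verts_with_proj_eq)
qed

text \<open>Reduces every fact about the parent to one description: the path to \<open>v\<close> is
  the path to \<open>u\<close> followed by the arc \<open>(u, v)\<close>.\<close>

lemma parent_eq:
  assumes "(u, v) \<in> parcs T" "u \<in> path_verts T r v"
  shows "parent T r v = u" "v \<noteq> r" "depth T r v = Suc (depth T r u)"
    "path_verts T r v = insert v (path_verts T r u)"
proof -
  have v: "v \<in> pverts T"
    using assms in_arcsD2 by blast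
  \<comment> \<open>Stated for every candidate \<open>w\<close>, not just for \<open>u\<close>:
    comparing the last arcs for \<open>w\<close> and \<open>u\<close> gives the uniqueness demanded
    by \<open>THE\<close> in \<open>parent\<close>.\<close>
  have path: "tree_path T r v = tree_path T r w @ [(w, v)]"
    if w: "(w, v) \<in> parcs T" "w \<in> path_verts T r v" for w
  proof -
    have ap: "apath r (tree_path T r v) v"
      using apath_tree_path root_in_verts v by blast
    then obtain q s where qs: "tree_path T r v = q @ s" "apath r q w" "apath w s v"
      using w apath_decomp[of r "tree_path T r v" v w] by (auto simp: path_verts_def)
    moreover have "apath w [(w, v)] v"
      using w v no_loops' by (auto simp: apath_simps)
    ultimately have "s = [(w, v)]" "tree_path T r w = q"
      using apath_unique tree_path_eq by blast+
    then show ?thesis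
      using qs by simp
  qed
  show "parent T r v = u"
    unfolding parent_def
  proof (rule the_equality)
    show "(v, u) \<in> parcs T \<and> u \<in> path_verts T r v"
      using assms arcs_symmetric by blast
  next
    fix w assume "(v, w) \<in> parcs T \<and> w \<in> path_verts T r v"
    then have "tree_path T r v = tree_path T r w @ [(w, v)]"
      using path arcs_symmetric by blast
    then show "w = u"
      using path[OF assms] by simp
  qed
  note p = path[OF assms]
  show "v \<noteq> r"
    using p tree_path_eq[of r "[]" r] root_in_verts by (auto simp: apath_Nil_iff)
  show "depth T r v = Suc (depth T r u)"
    by (simp add: depth_def tree_dist_def p)
  have "awalk r (tree_path T r u) u"
    using apath_tree_path root_in_verts assms in_arcsD1 by (auto simp: apath_def)
  moreover have "awalk u [(u, v)] v"
    using assms v by (auto simp: awalk_simps)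
  ultimately show "path_verts T r v = insert v (path_verts T r u)"
    using set_awalk_verts_append[of r "tree_path T r u" u "[(u, v)]" v]
      self_in_path_verts[of u] assms in_arcsD1 by (auto simp: path_verts_def p)
qed

lemma parent_props:
  assumes "v \<in> pverts T" "v \<noteq> r"
  shows "(parent T r v, v) \<in> parcs T" "parent T r v \<in> path_verts T r v"
proof -
  have ap: "apath r (tree_path T r v) v"
    using apath_tree_path root_in_verts assms by blast
  then obtain q e where q: "tree_path T r v = q @ [e]"
    using assms by (metis apath_Nil_iff rev_exhaust)
  then have "e = (fst e, v)" "e \<in> parcs T"
    using ap by (auto simp: apath_def awalk_simps prod_eq_iff)
  moreover have "fst e \<in> path_verts T r v"
    using awalk_verts_arc1[of e "tree_path T r v" r] q by (simp add: path_verts_def)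
  ultimately show "(parent T r v, v) \<in> parcs T" "parent T r v \<in> path_verts T r v"
    using parent_eq(1)[of "fst e" v] by auto
qed

lemma parent_in_verts: "v \<in> pverts T \<Longrightarrow> v \<noteq> r \<Longrightarrow> parent T r v \<in> pverts T"
  using parent_props(1) in_arcsD1 by blast

text \<open>If \<open>u\<close> is not on the path from the root to \<open>v\<close>, then that path
  can be prolonged by \<open>(v, u)\<close> without repeating a vertex, so it becomes the path to
  \<open>u\<close> and \<open>v\<close> is the parent of \<open>u\<close>.\<close>

lemma arc_parent_cases:
  assumes "(u, v) \<in> parcs T"
  obtains "v \<noteq> r" "u = parent T r v" | "u \<noteq> r" "v = parent T r u"
proof (cases "u \<in> path_verts T r v")
  case True
  then show ?thesis
    using that(1) parent_eq(1,2)[OF assms] by simp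
next
  case False
  have verts: "u \<in> pverts T" "v \<in> pverts T"
    using assms in_arcsD1 in_arcsD2 by blast+
  then have ap: "apath r (tree_path T r v) v"
    using apath_tree_path root_in_verts by blast
  then have "awlast r (tree_path T r v) = v"
    by (auto simp: apath_def)
  moreover have "apath v [(v, u)] u"
    using assms verts arcs_symmetric no_loops' by (auto simp: apath_simps)
  ultimately have "apath r (tree_path T r v @ [(v, u)]) u"
    using ap False by (auto simp: apath_append_iff path_verts_def)
  then have "v \<in> path_verts T r u"
    using tree_path_eq awalk_verts_arc1[of "(v, u)" "tree_path T r v @ [(v, u)]" r]
    by (simp add: path_verts_def)
  then show ?thesis
    using that(2) parent_eq(1,2)[OF arcs_symmetric[OF assms]] by simp
qed

lemma depth_le_if_in_path_verts:
  assumes "v \<in> path_verts T r w" "w \<in> pverts T"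
  shows "depth T r v \<le> depth T r w"
  using tree_dist_on_walk[of r "tree_path T r w" w v] apath_tree_path[of r w] root_in_verts assms
  by (auto simp: depth_def tree_dist_def apath_def path_verts_def)


lemma path_verts_root: "path_verts T r r = {r}"
proof -
  have "apath r [] r"
    by (simp add: apath_Nil_iff root_in_verts)
  then show ?thesis
    by (simp add: path_verts_def tree_path_eq)
qed

lemma depth_le_depth_add_dist:
  assumes "u \<in> pverts T" "v \<in> pverts T"
  shows "depth T r u \<le> depth T r v + tree_dist T u v"
  using tree_dist_triangle[of r v u] tree_dist_commute[of u v] assms root_in_verts
  by (simp add: depth_def)

text \<open>Ensures that the supremum in \<open>Lipschitz_norm\<close> ranges over a nonempty set,
  as \<open>cSUP_least\<close> requires.\<close>

lemma nonroot_exists: "pverts T - {r} \<noteq> {}"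
  using infinite_verts by (metis Diff_eq_empty_iff finite.emptyI finite_insert finite_subset)

lemma finite_depth_le: "finite {v \<in> pverts T. depth T r v \<le> n}"
  using finite_tree_ball[OF root_in_verts] by (simp add: depth_def)

section \<open>Increments along walks and the Lipschitz condition on arcs\<close>

lemma arc_increment:
  assumes "(u, v) \<in> parcs T"
  obtains w where "w \<in> pverts T - {r}" "w = u \<or> w = v" "cmod (f v - f u) = increment T r f w"
proof -
  have "u \<in> pverts T" "v \<in> pverts T"
    using assms in_arcsD1 in_arcsD2 by blast+
  then show ?thesis
    using assms that by (rule_tac arc_parent_cases[OF assms]) (auto simp: increment_def norm_minus_commute)
qed

text \<open>Telescoping along the walk. The bound is assumed only at vertices of the walk, so that a
  small \<open>B\<close> can be used for walks far from the root.\<close>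

lemma norm_diff_le_walk:
  assumes "awalk u p v"
    and "\<And>w. w \<in> set (awalk_verts u p) \<Longrightarrow> w \<noteq> r \<Longrightarrow> increment T r f w \<le> B"
  shows "cmod (f v - f u) \<le> B * length p"
  using assms
proof (induction p arbitrary: u)
  case Nil
  then show ?case
    by (simp add: awalk_Nil_iff)
next
  case (Cons e p)
  then have e: "e \<in> parcs T" "fst e = u" "awalk (snd e) p v"
    by (auto simp: awalk_Cons_iff)
  then obtain w where w: "w \<noteq> r" "w = u \<or> w = snd e" "cmod (f (snd e) - f u) = increment T r f w"
    using arc_increment[of u "snd e" f] by (metis DiffE prod.collapse singletonI)
  have "snd e \<in> set (awalk_verts (snd e) p)"
    using hd_in_awalk_verts e(3) by simp
  then have "cmod (f (snd e) - f u) \<le> B"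
    using Cons.prems(2)[of w] w e(2) by auto
  moreover have "cmod (f v - f (snd e)) \<le> B * length p"
    using Cons.IH[OF e(3)] Cons.prems(2) by simp
  moreover have "cmod (f v - f u) \<le> cmod (f v - f (snd e)) + cmod (f (snd e) - f u)"
    using norm_triangle_ineq[of "f v - f (snd e)" "f (snd e) - f u"] by simp
  ultimately show ?case
    by (simp add: algebra_simps)
qed

text \<open>A vertex and its parent are at distance 1, which gives one direction. Conversely, a
  bound on arcs adds up along a walk that realises the distance.\<close>

lemma Lipschitz_map_iff:
  assumes "\<phi> \<in> pverts T \<rightarrow> pverts T"
  shows "Lipschitz_map T \<phi> \<longleftrightarrow>
    (\<exists>K. \<forall>v \<in> pverts T - {r}. tree_dist T (\<phi> (parent T r v)) (\<phi> v) \<le> K)"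
proof
  assume "Lipschitz_map T \<phi>"
  then obtain L where L: "\<And>v w. v \<in> pverts T \<Longrightarrow> w \<in> pverts T \<Longrightarrow> v \<noteq> w \<Longrightarrow>
      real (tree_dist T (\<phi> v) (\<phi> w)) / real (tree_dist T v w) \<le> L"
    unfolding Lipschitz_map_def bdd_above_def by blast
  have "tree_dist T (\<phi> (parent T r v)) (\<phi> v) \<le> nat \<lceil>L\<rceil>" if v: "v \<in> pverts T - {r}" for v
  proof -
    have arc: "(parent T r v, v) \<in> parcs T"
      using parent_props v by blast
    then have "parent T r v \<noteq> v" "parent T r v \<in> pverts T"
      using no_loops' in_arcsD1 by blast+
    moreover from this have "tree_dist T (parent T r v) v = 1"
      using tree_dist_arc_le[OF arc] tree_dist_eq_0_iff[of "parent T r v" v] v by force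
    ultimately show ?thesis
      using L[of "parent T r v" v] v by (simp add: le_nat_iff) linarith
  qed
  then show "\<exists>K. \<forall>v \<in> pverts T - {r}. tree_dist T (\<phi> (parent T r v)) (\<phi> v) \<le> K"
    by blast
next
  assume "\<exists>K. \<forall>v \<in> pverts T - {r}. tree_dist T (\<phi> (parent T r v)) (\<phi> v) \<le> K"
  then obtain K where K: "\<And>v. v \<in> pverts T - {r} \<Longrightarrow> tree_dist T (\<phi> (parent T r v)) (\<phi> v) \<le> K"
    by blast
  have arc: "tree_dist T (\<phi> u) (\<phi> v) \<le> K" if uv: "(u, v) \<in> parcs T" for u v
  proof -
    have "u \<in> pverts T" "v \<in> pverts T"
      using uv in_arcsD1 in_arcsD2 by blast+
    moreover from this have "\<phi> u \<in> pverts T" "\<phi> v \<in> pverts T"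
      using assms by auto
    ultimately show ?thesis
      using K[of u] K[of v] tree_dist_commute[of "\<phi> u" "\<phi> v"]
      by (rule_tac arc_parent_cases[OF uv]) auto
  qed
  have walk: "tree_dist T (\<phi> u) (\<phi> v) \<le> K * length p" if "awalk u p v" for u p v
    using that
  proof (induction p arbitrary: u)
    case Nil
    then show ?case
      using assms by (auto simp: awalk_Nil_iff Pi_iff)
  next
    case (Cons e p)
    then have e: "e \<in> parcs T" "fst e = u" "awalk (snd e) p v"
      by (auto simp: awalk_Cons_iff)
    have "\<phi> u \<in> pverts T" "\<phi> (snd e) \<in> pverts T" "\<phi> v \<in> pverts T"
      using assms e Cons.prems by auto
    then have "tree_dist T (\<phi> u) (\<phi> v)
        \<le> tree_dist T (\<phi> u) (\<phi> (snd e)) + tree_dist T (\<phi> (snd e)) (\<phi> v)"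
      by (rule tree_dist_triangle)
    moreover have "tree_dist T (\<phi> u) (\<phi> (snd e)) \<le> K"
      using arc[of u "snd e"] e by auto
    ultimately show ?case
      using Cons.IH[OF e(3)] by simp
  qed
  have "real (tree_dist T (\<phi> v) (\<phi> w)) / real (tree_dist T v w) \<le> real K"
    if vw: "v \<in> pverts T" "w \<in> pverts T" "v \<noteq> w" for v w
  proof -
    obtain p where p: "awalk v p w" "length p = tree_dist T v w"
      using tree_dist_walk[OF vw(1,2)] by blast
    have "tree_dist T (\<phi> v) (\<phi> w) \<le> K * tree_dist T v w"
      using walk[OF p(1)] p(2) by simp
    then have "real (tree_dist T (\<phi> v) (\<phi> w)) \<le> real K * real (tree_dist T v w)"
      by (metis of_nat_le_iff of_nat_mult)
    moreover have "tree_dist T v w > 0"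
      using tree_dist_eq_0_iff[of v w] vw by simp
    ultimately show ?thesis
      by (simp add: divide_le_eq)
  qed
  then show "Lipschitz_map T \<phi>"
    unfolding Lipschitz_map_def bdd_above_def by blast
qed

section \<open>Norm estimates and membership in the little Lipschitz space\<close>

lemma increment_le_Lipschitz_norm:
  assumes "f \<in> Lipschitz_space T r" "v \<in> pverts T - {r}"
  shows "increment T r f v \<le> Lipschitz_norm T r f"
proof -
  have "increment T r f v \<le> (SUP v \<in> pverts T - {r}. increment T r f v)"
    using assms by (intro cSUP_upper) (auto simp: Lipschitz_space_def)
  then show ?thesis
    by (simp add: Lipschitz_norm_def)
qed

lemma Lipschitz_norm_le:
  assumes "cmod (f r) \<le> B" "\<And>v. v \<in> pverts T - {r} \<Longrightarrow> increment T r f v \<le> B"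
  shows "Lipschitz_norm T r f \<le> B"
  unfolding Lipschitz_norm_def using assms nonroot_exists by (auto intro!: cSUP_least)

lemma little_Lipschitz_spaceI_finite:
  assumes "f \<in> extensional (pverts T)"
    and fin: "finite {v \<in> pverts T - {r}. increment T r f v \<noteq> 0}"
  shows "f \<in> little_Lipschitz_space T r"
proof -
  let ?S = "{v \<in> pverts T - {r}. increment T r f v \<noteq> 0}"
  have "increment T r f ` (pverts T - {r}) \<subseteq> insert 0 (increment T r f ` ?S)"
    by auto
  then have "finite (increment T r f ` (pverts T - {r}))"
    using fin by (meson finite_imageI finite_insert finite_subset)
  then have "f \<in> Lipschitz_space T r"
    using assms(1) by (simp add: Lipschitz_space_def)
  moreover have "\<exists>N. \<forall>v \<in> pverts T - {r}. depth T r v > N \<longrightarrow> increment T r f v < \<epsilon>" if "\<epsilon> > 0" for \<epsilon>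
  proof -
    \<comment> \<open>For empty \<open>?S\<close> the value of \<open>Max\<close> is irrelevant,
      because it is compared only with depths of members of \<open>?S\<close>.\<close>
    have "increment T r f v < \<epsilon>" if v: "v \<in> pverts T - {r}" "depth T r v > Max (depth T r ` ?S)" for v
    proof -
      have "v \<notin> ?S"
      proof
        assume "v \<in> ?S"
        then have "depth T r v \<le> Max (depth T r ` ?S)"
          using fin by (intro Max_ge) auto
        then show False
          using v(2) by simp
      qed
      then show ?thesis
        using v(1) \<open>\<epsilon> > 0\<close> by simp
    qed
    then show ?thesis
      by blast
  qed
  ultimately show ?thesis
    by (simp add: little_Lipschitz_space_def)
qed

section \<open>Truncated distances as test functions\<close>

text \<open>Subtracting the value at the root leaves all increments unchanged and makes the term
  \<open>cmod (f r)\<close> of the norm vanish, so the norm is bounded by 1 independently of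
  \<open>c\<close> and \<open>n\<close>.\<close>

definition dist_cutoff :: "'a \<Rightarrow> nat \<Rightarrow> 'a \<Rightarrow> complex" where
  "dist_cutoff c n = (\<lambda>v \<in> pverts T.
    of_nat (min (tree_dist T c v) n) - of_nat (min (tree_dist T c r) n))"

lemma norm_of_nat_diff: "cmod (of_nat a - of_nat b) = \<bar>real a - real b\<bar>"
  by (metis norm_of_real of_real_diff of_real_of_nat_eq)

lemma dist_cutoff_diff:
  assumes "u \<in> pverts T" "v \<in> pverts T"
  shows "cmod (dist_cutoff c n u - dist_cutoff c n v)
    = \<bar>real (min (tree_dist T c u) n) - real (min (tree_dist T c v) n)\<bar>"
  using assms norm_of_nat_diff by (simp add: dist_cutoff_def)

lemma tree_dist_parent:
  assumes "c \<in> pverts T" "v \<in> pverts T" "v \<noteq> r"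
  shows "tree_dist T c v \<le> Suc (tree_dist T c (parent T r v))"
    "tree_dist T c (parent T r v) \<le> Suc (tree_dist T c v)"
proof -
  have p: "parent T r v \<in> pverts T" "tree_dist T (parent T r v) v \<le> 1"
    using assms parent_in_verts parent_props(1) tree_dist_arc_le by blast+
  then show "tree_dist T c v \<le> Suc (tree_dist T c (parent T r v))"
    "tree_dist T c (parent T r v) \<le> Suc (tree_dist T c v)"
    using tree_dist_triangle[of c v "parent T r v"] tree_dist_triangle[of c "parent T r v" v]
      tree_dist_commute[of v "parent T r v"] assms by auto
qed

lemma dist_cutoff_increment_le:
  assumes "c \<in> pverts T" "v \<in> pverts T" "v \<noteq> r"
  shows "increment T r (dist_cutoff c n) v \<le> 1"
  using tree_dist_parent[OF assms] assms parent_in_verts by (simp add: increment_def dist_cutoff_diff)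

lemma dist_cutoff_in_little_Lipschitz_space:
  assumes "c \<in> pverts T"
  shows "dist_cutoff c n \<in> little_Lipschitz_space T r"
proof (rule little_Lipschitz_spaceI_finite)
  show "dist_cutoff c n \<in> extensional (pverts T)"
    by (simp add: dist_cutoff_def)
  \<comment> \<open>Beyond this radius the parent, at most one step closer to \<open>c\<close>, also
    has distance at least \<open>n\<close>; truncation then gives both vertices the same
    value.\<close>
  have "tree_dist T c v \<le> Suc n"
    if "v \<in> pverts T - {r}" "increment T r (dist_cutoff c n) v \<noteq> 0" for v
  proof (rule ccontr)
    assume "\<not> ?thesis"
    then show False
      using tree_dist_parent[of c v] that assms parent_in_verts
      by (simp add: increment_def dist_cutoff_diff)
  qed
  then have "{v \<in> pverts T - {r}. increment T r (dist_cutoff c n) v \<noteq> 0}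
      \<subseteq> {v \<in> pverts T. tree_dist T c v \<le> Suc n}"
    by auto
  then show "finite {v \<in> pverts T - {r}. increment T r (dist_cutoff c n) v \<noteq> 0}"
    using finite_tree_ball[OF assms] by (rule finite_subset)
qed

lemma Lipschitz_norm_dist_cutoff_le:
  assumes "c \<in> pverts T"
  shows "Lipschitz_norm T r (dist_cutoff c n) \<le> 1"
  using assms dist_cutoff_increment_le root_in_verts
  by (intro Lipschitz_norm_le) (auto simp: dist_cutoff_def)

section \<open>Increments of the composition and nonconstant vertices\<close>

lemma increment_composition:
  assumes "v \<in> pverts T - {r}"
  shows "increment T r (composition_operator T \<phi> f) v = cmod (f (\<phi> v) - f (\<phi> (parent T r v)))"
  using assms parent_in_verts by (simp add: increment_def composition_operator_def compose_def)

text \<open>The path between the two images has length at most \<open>K\<close>, so it climbs at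
  most \<open>K\<close> levels towards the root; only increments of \<open>f\<close> at such depths
  enter. Taking \<open>B\<close> to be the norm gives boundedness, and a small \<open>B\<close>
  gives decay.\<close>

lemma increment_composition_le:
  assumes maps: "\<phi> \<in> pverts T \<rightarrow> pverts T" and v: "v \<in> pverts T - {r}"
    and dist: "tree_dist T (\<phi> (parent T r v)) (\<phi> v) \<le> K"
    and B: "0 \<le> B" "\<And>w. w \<in> pverts T - {r} \<Longrightarrow>
      depth T r w + K \<ge> depth T r (\<phi> (parent T r v)) \<Longrightarrow> increment T r f w \<le> B"
  shows "increment T r (composition_operator T \<phi> f) v \<le> B * K"
proof -
  have im: "\<phi> v \<in> pverts T" "\<phi> (parent T r v) \<in> pverts T"
    using v maps parent_in_verts by auto
  then obtain p where p: "awalk (\<phi> (parent T r v)) p (\<phi> v)"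
      "length p = tree_dist T (\<phi> (parent T r v)) (\<phi> v)"
    using tree_dist_walk by blast
  have "cmod (f (\<phi> v) - f (\<phi> (parent T r v))) \<le> B * length p"
  proof (rule norm_diff_le_walk[OF p(1)])
    fix w assume w: "w \<in> set (awalk_verts (\<phi> (parent T r v)) p)" "w \<noteq> r"
    then have "w \<in> pverts T"
      using p(1) by (auto elim!: awalkE')
    moreover have "tree_dist T (\<phi> (parent T r v)) w \<le> K"
      using tree_dist_on_walk[OF p(1) w(1)] p(2) dist by simp
    ultimately show "increment T r f w \<le> B"
      using depth_le_depth_add_dist[of "\<phi> (parent T r v)" w] im w(2) by (intro B) auto
  qed
  also have "\<dots> \<le> B * K"
    using dist p(2) B(1) by (simp add: mult_left_mono)
  finally show ?thesis
    by (simp add: increment_composition[OF v])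
qed

lemma composition_linear:
  assumes "\<phi> \<in> pverts T \<rightarrow> pverts T"
  shows "composition_operator T \<phi> (\<lambda>v \<in> pverts T. f v + g v)
      = (\<lambda>v \<in> pverts T. composition_operator T \<phi> f v + composition_operator T \<phi> g v)"
    "composition_operator T \<phi> (\<lambda>v \<in> pverts T. c * f v)
      = (\<lambda>v \<in> pverts T. c * composition_operator T \<phi> f v)"
  using assms by (auto simp: composition_operator_def compose_def fun_eq_iff)

text \<open>The sector of the parent contains both vertices. Hence a nonzero increment of a
  composition at \<open>v\<close> puts the parent, rather than \<open>v\<close> itself, among the
  nonconstant vertices.\<close>

lemma nonconstant_if_parent_image_neq:
  assumes "v \<in> pverts T - {r}" "\<phi> v \<noteq> \<phi> (parent T r v)"
  shows "parent T r v \<in> nonconstant_verts T r \<phi>"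
proof -
  have "v \<in> sector T r (parent T r v)" "parent T r v \<in> sector T r (parent T r v)"
    using assms parent_props(2) parent_in_verts self_in_path_verts by (auto simp: sector_def)
  then have "\<not> \<phi> constant_on sector T r (parent T r v)"
    using assms(2) unfolding constant_on_def by metis
  then show ?thesis
    using assms(1) parent_in_verts by (simp add: nonconstant_verts_def)
qed

text \<open>Take \<open>w\<close> of least depth among the vertices of the sector whose image
  differs from \<open>\<phi> v\<close>. As \<open>w\<close> is not \<open>v\<close>, its parent
  still lies in the sector, and minimality forces the parent's image to be
  \<open>\<phi> v\<close>.\<close>

lemma nonconstant_vert_jump:
  assumes "v \<in> nonconstant_verts T r \<phi>"
  obtains w where "w \<in> pverts T - {r}" "depth T r v < depth T r w"
    "\<phi> (parent T r w) = \<phi> v" "\<phi> w \<noteq> \<phi> v"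
proof -
  have "\<exists>w. w \<in> sector T r v \<and> \<phi> w \<noteq> \<phi> v"
    using assms by (auto simp: nonconstant_verts_def constant_on_def)
  then obtain w where w: "w \<in> sector T r v" "\<phi> w \<noteq> \<phi> v"
    and min: "\<And>x. x \<in> sector T r v \<Longrightarrow> \<phi> x \<noteq> \<phi> v \<Longrightarrow> depth T r w \<le> depth T r x"
    using ex_has_least_nat[of "\<lambda>w. w \<in> sector T r v \<and> \<phi> w \<noteq> \<phi> v" _ "depth T r"] by blast
  have wv: "w \<in> pverts T" "v \<in> path_verts T r w" "w \<noteq> v"
    using w by (auto simp: sector_def)
  then have "w \<noteq> r"
    using path_verts_root by auto
  note props = parent_props[OF wv(1) this]
  have p: "v \<in> path_verts T r (parent T r w)" "depth T r w = Suc (depth T r (parent T r w))"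
    "parent T r w \<in> pverts T"
    using parent_eq[OF props] wv in_arcsD1[OF props(1)] by auto
  then have "parent T r w \<in> sector T r v"
    by (simp add: sector_def)
  then have "\<phi> (parent T r w) = \<phi> v"
    using min[of "parent T r w"] p(2) by auto
  then show ?thesis
    using that[of w] depth_le_if_in_path_verts[OF p(1,3)] p(2) wv \<open>w \<noteq> r\<close> w(2) by auto
qed

section \<open>Necessity of the two conditions\<close>

lemma Lipschitz_map_if_bounded:
  assumes maps: "\<phi> \<in> pverts T \<rightarrow> pverts T"
    and bounded: "bounded_operator_on (pverts T) (little_Lipschitz_space T r) (Lipschitz_norm T r)
      (composition_operator T \<phi>)"
  shows "Lipschitz_map T \<phi>"
proof -
  obtain K where K: "\<And>f. f \<in> little_Lipschitz_space T r \<Longrightarrow>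
      Lipschitz_norm T r (composition_operator T \<phi> f) \<le> K * Lipschitz_norm T r f"
    and into: "\<And>f. f \<in> little_Lipschitz_space T r \<Longrightarrow>
      composition_operator T \<phi> f \<in> little_Lipschitz_space T r"
    using bounded unfolding bounded_operator_on_def by blast
  \<comment> \<open>The absolute value is taken because the operator bound \<open>K\<close> is an
    arbitrary real, possibly negative.\<close>
  have "tree_dist T (\<phi> (parent T r v)) (\<phi> v) \<le> nat \<lceil>\<bar>K\<bar>\<rceil>" if v: "v \<in> pverts T - {r}" for v
  proof -
    define c where "c = \<phi> (parent T r v)"
    \<comment> \<open>Cutting off at exactly the distance to be bounded leaves the value at
      \<open>\<phi> v\<close> untruncated, so the increment of the composition at \<open>v\<close>
      equals that distance.\<close>
    define f where "f = dist_cutoff c (tree_dist T c (\<phi> v))"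
    have im: "c \<in> pverts T" "\<phi> v \<in> pverts T"
      using v maps parent_in_verts by (auto simp: c_def)
    then have f: "f \<in> little_Lipschitz_space T r" "Lipschitz_norm T r f \<le> 1"
      using dist_cutoff_in_little_Lipschitz_space Lipschitz_norm_dist_cutoff_le
      by (auto simp: f_def)
    have "0 \<le> Lipschitz_norm T r f"
      by (simp add: Lipschitz_norm_def le_max_iff_disj)
    then have "K * Lipschitz_norm T r f \<le> \<bar>K\<bar>"
      using f(2) by (metis abs_ge_self abs_ge_zero mult.right_neutral mult_mono)
    have "real (tree_dist T c (\<phi> v)) = increment T r (composition_operator T \<phi> f) v"
      unfolding increment_composition[OF v] c_def[symmetric]
      using im by (simp add: f_def dist_cutoff_diff)
    also have "\<dots> \<le> Lipschitz_norm T r (composition_operator T \<phi> f)"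
      using into[OF f(1)] v
      by (intro increment_le_Lipschitz_norm) (auto simp: little_Lipschitz_space_def)
    also have "\<dots> \<le> \<bar>K\<bar>"
      using K[OF f(1)] \<open>K * Lipschitz_norm T r f \<le> \<bar>K\<bar>\<close> by linarith
    finally show ?thesis
      unfolding c_def by linarith
  qed
  then show ?thesis
    unfolding Lipschitz_map_iff[OF maps] by blast
qed

lemma depth_tends_to_infinity_if_bounded:
  assumes maps: "\<phi> \<in> pverts T \<rightarrow> pverts T"
    and bounded: "bounded_operator_on (pverts T) (little_Lipschitz_space T r) (Lipschitz_norm T r)
      (composition_operator T \<phi>)"
  shows "depth_tends_to_infinity_on T r \<phi> (nonconstant_verts T r \<phi>)"
  unfolding depth_tends_to_infinity_on_def
proof
  fix M
  let ?B = "{u \<in> pverts T. depth T r u \<le> M}"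
  \<comment> \<open>One threshold for each possible image \<open>u\<close> of depth at most
    \<open>M\<close>; since \<open>?B\<close> is finite, the largest of them serves for all images
    at once.\<close>
  have "\<forall>u \<in> ?B. \<exists>N. \<forall>v \<in> pverts T - {r}. depth T r v > N \<longrightarrow>
      increment T r (composition_operator T \<phi> (dist_cutoff u 1)) v < 1"
  proof
    fix u assume "u \<in> ?B"
    then have "composition_operator T \<phi> (dist_cutoff u 1) \<in> little_Lipschitz_space T r"
      using bounded dist_cutoff_in_little_Lipschitz_space by (auto simp: bounded_operator_on_def)
    then show "\<exists>N. \<forall>v \<in> pverts T - {r}. depth T r v > N \<longrightarrow>
        increment T r (composition_operator T \<phi> (dist_cutoff u 1)) v < 1"
      by (simp add: little_Lipschitz_space_def)
  qed
  then obtain N where N: "\<And>u v. u \<in> ?B \<Longrightarrow> v \<in> pverts T - {r} \<Longrightarrow> depth T r v > N u \<Longrightarrow>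
      increment T r (composition_operator T \<phi> (dist_cutoff u 1)) v < 1"
    by metis
  have "depth T r (\<phi> v) > M" if v: "v \<in> nonconstant_verts T r \<phi>" "depth T r v > Max (N ` ?B)" for v
  proof (rule ccontr)
    assume "\<not> depth T r (\<phi> v) > M"
    moreover have "v \<in> pverts T"
      using v by (simp add: nonconstant_verts_def)
    ultimately have u: "\<phi> v \<in> ?B"
      using maps by auto
    obtain w where w: "w \<in> pverts T - {r}" "depth T r v < depth T r w"
      "\<phi> (parent T r w) = \<phi> v" "\<phi> w \<noteq> \<phi> v"
      using nonconstant_vert_jump[OF v(1)] by blast
    have "N (\<phi> v) \<le> Max (N ` ?B)"
      using u finite_depth_le by (intro Max_ge) auto
    then have "increment T r (composition_operator T \<phi> (dist_cutoff (\<phi> v) 1)) w < 1"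
      using N[OF u w(1)] v(2) w(2) by simp
    moreover have "\<phi> w \<in> pverts T"
      using maps w(1) by auto
    moreover from this have "tree_dist T (\<phi> v) (\<phi> w) \<noteq> 0"
      using tree_dist_eq_0_iff[of "\<phi> v" "\<phi> w"] u w(4) by auto
    \<comment> \<open>The distance from \<open>\<phi> v\<close> truncated at 1 is 0 at the image of
      the parent of \<open>w\<close> and 1 at \<open>\<phi> w\<close>, so the increment at
      \<open>w\<close> is exactly 1.\<close>
    ultimately show False
      using u unfolding increment_composition[OF w(1)] w(3) by (simp add: dist_cutoff_diff)
  qed
  then show "\<exists>N. \<forall>v \<in> nonconstant_verts T r \<phi>. depth T r v > N \<longrightarrow> depth T r (\<phi> v) > M"
    by blast
qed

section \<open>Sufficiency of the two conditions\<close>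

lemma bounded_if_Lipschitz_map:
  assumes maps: "\<phi> \<in> pverts T \<rightarrow> pverts T"
    and "Lipschitz_map T \<phi>"
    and lim: "depth_tends_to_infinity_on T r \<phi> (nonconstant_verts T r \<phi>)"
  shows "bounded_operator_on (pverts T) (little_Lipschitz_space T r) (Lipschitz_norm T r)
    (composition_operator T \<phi>)"
proof -
  obtain K where K: "\<And>v. v \<in> pverts T - {r} \<Longrightarrow> tree_dist T (\<phi> (parent T r v)) (\<phi> v) \<le> K"
    using assms(2) unfolding Lipschitz_map_iff[OF maps] by blast
  let ?C = "composition_operator T \<phi>" and ?N = "Lipschitz_norm T r"
  have N_nonneg: "0 \<le> ?N f" for f
    by (simp add: Lipschitz_norm_def le_max_iff_disj)
  have inc: "increment T r (?C f) v \<le> ?N f * K"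
    if "f \<in> Lipschitz_space T r" "v \<in> pverts T - {r}" for f v
    using that K N_nonneg increment_le_Lipschitz_norm by (intro increment_composition_le[OF maps]) auto
  have "?C f \<in> little_Lipschitz_space T r" if f: "f \<in> little_Lipschitz_space T r" for f
  proof -
    have "f \<in> Lipschitz_space T r"
      using f by (simp add: little_Lipschitz_space_def)
    then have "bdd_above (increment T r (?C f) ` (pverts T - {r}))"
      using inc by (intro bdd_aboveI2)
    then have "?C f \<in> Lipschitz_space T r"
      by (simp add: Lipschitz_space_def composition_operator_def)
    moreover have "\<exists>N. \<forall>v \<in> pverts T - {r}. depth T r v > N \<longrightarrow> increment T r (?C f) v < \<epsilon>"
      if "\<epsilon> > 0" for \<epsilon>
    proof -
      \<comment> \<open>Dividing by \<open>K + 1\<close> rather than \<open>K\<close> covers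
        \<open>K = 0\<close> and makes \<open>\<delta> * K < \<epsilon>\<close> strict.\<close>
      define \<delta> where "\<delta> = \<epsilon> / (K + 1)"
      have \<delta>: "\<delta> > 0" "\<delta> * K < \<epsilon>"
        using \<open>\<epsilon> > 0\<close> by (auto simp: \<delta>_def field_simps)
      obtain M where M: "\<And>w. w \<in> pverts T - {r} \<Longrightarrow> depth T r w > M \<Longrightarrow> increment T r f w < \<delta>"
        using f \<delta>(1) unfolding little_Lipschitz_space_def by blast
      \<comment> \<open>The margin \<open>K\<close> compensates for the levels that a path of length
        at most \<open>K\<close> can climb: all its vertices remain deeper than
        \<open>M\<close>.\<close>
      obtain N where N: "\<And>v. v \<in> nonconstant_verts T r \<phi> \<Longrightarrow> depth T r v > N \<Longrightarrow>
          depth T r (\<phi> v) > M + K"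
        using lim unfolding depth_tends_to_infinity_on_def by blast
      \<comment> \<open>The threshold is \<open>Suc N\<close> because the limit condition is applied
        to the parent of \<open>v\<close>, one level higher.\<close>
      have "increment T r (?C f) v < \<epsilon>" if v: "v \<in> pverts T - {r}" "depth T r v > Suc N" for v
      proof (cases "\<phi> v = \<phi> (parent T r v)")
        case True
        then show ?thesis
          using \<open>\<epsilon> > 0\<close> by (simp add: increment_composition[OF v(1)])
      next
        case False
        have "depth T r v = Suc (depth T r (parent T r v))"
          using parent_eq(3) parent_props v(1) by blast
        then have "depth T r (\<phi> (parent T r v)) > M + K"
          using N[OF nonconstant_if_parent_image_neq[OF v(1) False]] v(2) by simp
        then have "increment T r (?C f) v \<le> \<delta> * K"
          using M \<delta>(1) K[OF v(1)]
          by (intro increment_composition_le[OF maps v(1)]) (auto intro!: less_imp_le)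
        then show ?thesis
          using \<delta>(2) by simp
      qed
      then show ?thesis
        by blast
    qed
    ultimately show ?thesis
      by (simp add: little_Lipschitz_space_def)
  qed
  \<comment> \<open>The part \<open>1 + depth T r (\<phi> r)\<close> controls the value at the root,
    by walking from \<open>r\<close> to \<open>\<phi> r\<close>, and \<open>K\<close> controls the
    increments; the sum dominates both.\<close>
  moreover have "?N (?C f) \<le> (1 + depth T r (\<phi> r) + K) * ?N f"
    if "f \<in> little_Lipschitz_space T r" for f
  proof (rule Lipschitz_norm_le)
    have f: "f \<in> Lipschitz_space T r"
      using that by (simp add: little_Lipschitz_space_def)
    obtain p where p: "awalk r p (\<phi> r)" "length p = depth T r (\<phi> r)"
      using tree_dist_walk[of r "\<phi> r"] maps root_in_verts by (auto simp: depth_def)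
    have "cmod (f (\<phi> r) - f r) \<le> ?N f * length p"
      using p(1) f by (intro norm_diff_le_walk increment_le_Lipschitz_norm) (auto elim!: awalkE')
    moreover have "cmod (f r) \<le> ?N f"
      by (simp add: Lipschitz_norm_def)
    moreover have "?C f r = f (\<phi> r)"
      by (simp add: composition_operator_def compose_def root_in_verts)
    moreover have "cmod (f (\<phi> r)) \<le> cmod (f (\<phi> r) - f r) + cmod (f r)"
      using norm_triangle_ineq[of "f (\<phi> r) - f r" "f r"] by simp
    moreover have "0 \<le> K * ?N f"
      using N_nonneg by simp
    ultimately show "cmod (?C f r) \<le> (1 + depth T r (\<phi> r) + K) * ?N f"
      using p(2) by (simp add: algebra_simps)
    fix v assume "v \<in> pverts T - {r}"
    then have "increment T r (?C f) v \<le> ?N f * K"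
      using inc f by blast
    moreover have "0 \<le> (1 + depth T r (\<phi> r)) * ?N f"
      using N_nonneg by simp
    ultimately show "increment T r (?C f) v \<le> (1 + depth T r (\<phi> r) + K) * ?N f"
      by (simp add: algebra_simps)
  qed
  ultimately show ?thesis
    unfolding bounded_operator_on_def using composition_linear[OF maps] by blast
qed

text \<open>Beyond the largest depth in \<open>A\<close> the condition is vacuous. Thus both
  alternatives in the theorem amount to the limit condition alone.\<close>

lemma depth_tends_to_infinity_on_finite:
  assumes "finite A"
  shows "depth_tends_to_infinity_on T r \<phi> A"
proof -
  have "depth T r v \<le> Max (depth T r ` A)" if "v \<in> A" for v
    using assms that by (intro Max_ge) auto
  then have "\<forall>v \<in> A. depth T r v > Max (depth T r ` A) \<longrightarrow> depth T r (\<phi> v) > M" for M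
    by (metis linorder_not_less)
  then show ?thesis
    unfolding depth_tends_to_infinity_on_def by blast
qed

end

theorem theorem3p6:
  fixes T :: "'a pair_pre_digraph" and r :: 'a and \<phi> :: "'a \<Rightarrow> 'a"
  assumes "infinite_rooted_tree T r"
    and "\<phi> \<in> pverts T \<rightarrow> pverts T"
  shows "bounded_operator_on (pverts T) (little_Lipschitz_space T r) (Lipschitz_norm T r)
           (composition_operator T \<phi>) \<longleftrightarrow>
         Lipschitz_map T \<phi> \<and>
         (finite (nonconstant_verts T r \<phi>) \<or>
          infinite (nonconstant_verts T r \<phi>) \<and>
          depth_tends_to_infinity_on T r \<phi> (nonconstant_verts T r \<phi>))"
proof -
  interpret infinite_rooted_tree T r
    by (rule assms(1))
  show ?thesis
    using Lipschitz_map_if_bounded[OF assms(2)] depth_tends_to_infinity_if_bounded[OF assms(2)]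
      bounded_if_Lipschitz_map[OF assms(2)] depth_tends_to_infinity_on_finite
    by blast
qed

end
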